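(* Let $X$ be a set. (i) $\mathrm{Med}(X)$ is the free median algebra on the set $X$. In other words, for every median algebra $M$ and every function $\varphi: X\to M$ there exists a unique median morphism $f:\mathrm{Med}(X)\to M$ with $\varphi=f\circ\iota$. (ii) The map $\iota^{\#}:\mathrm{Med}(X)^\circ\to\mathscr{P}X$, $H\mapsto\iota^{-1}(H)$, is an isomorphism of poc sets. (iii) $\mathrm{Med}(X)=\mathscr{P}X^\circ$ if and only if $X$ is finite.
   Context: A median algebra is a set $M$ with a map $m: M^3\to M$ such that: $m(x,y,z)=m(x,z,y)=m(y,z,x)$; $m(x,x,y)=x$; $m(m(x,y,z),u,v)=m(x,m(y,u,v),m(z,u,v))$. A median morphism is a map preserving $m$. A subset $C$ is convex if $m(x,y,z)\in C$ for all $x,y\in C$, $z\in M$; a half space is a subset $H$ with $H$ and $M\setminus H$ both convex. $M^\circ$ denotes the poc set of half spaces of $M$, ordered by inclusion, with $H^*=M\setminus H$ and $0=\varnothing$. A poc set is a partially ordered set $P$ with a smallest element $0$ and an involution $^*$ such that $a\le b\Rightarrow b^*\le a^*$, and $a\le a^*\Rightarrow a=0$. By standing convention median algebras are nonempty and poc sets satisfy $0\neq0^*$ (so $X$ is taken nonempty). A poc isomorphism is a bijection preserving and reflecting order, fixing $0$ and commuting with $^*$. An ultra filter in $P$ is an upper set $U\subset P$ such that $P$ is the disjoint union of $U$ and $U^*=\{a^*: a\in U\}$. $P^\circ$ is the set of ultra filters of $P$, a median algebra with the Boolean median $m(U,V,W)=(U\cap V)\cup(V\cap W)\cup(W\cap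 U)$. The power set $\mathscr{P}X$ is regarded as a poc set ordered by inclusion, with $a^*=X\setminus a$ and $0=\varnothing$. (So an ultra filter here is only required to contain exactly one of $a$, $X\setminus a$ for each $a$ and to be upward closed; it need not be closed under intersections.) For $x\in X$ let $\pi(x)=\{a\in\mathscr{P}X: x\in a\}\in\mathscr{P}X^\circ:=(\mathscr{P}X)^\circ$. $\mathrm{Med}(X)$ is the median subalgebra of $\mathscr{P}X^\circ$ generated by $\pi(X)$, and $\iota: X\to\mathrm{Med}(X)$ is $\iota(x):=\pi(x)$. *)

theory Defs
  imports "HOL-Algebra.Congruence"
begin

record 'a median_struct = "'a partial_object" +
  med :: "'a \<Rightarrow> 'a \<Rightarrow> 'a \<Rightarrow> 'a"

locale median_algebra =
  fixes M :: "'a median_struct"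
  assumes nonempty: "carrier M \<noteq> {}"
    and med_closed:
      "\<lbrakk>x \<in> carrier M; y \<in> carrier M; z \<in> carrier M\<rbrakk> \<Longrightarrow> med M x y z \<in> carrier M"
    and med_swap:
      "\<lbrakk>x \<in> carrier M; y \<in> carrier M; z \<in> carrier M\<rbrakk> \<Longrightarrow> med M x y z = med M x z y"
    and med_rotate:
      "\<lbrakk>x \<in> carrier M; y \<in> carrier M; z \<in> carrier M\<rbrakk> \<Longrightarrow> med M x y z = med M y z x"
    and med_majority:
      "\<lbrakk>x \<in> carrier M; y \<in> carrier M\<rbrakk> \<Longrightarrow> med M x x y = x"
    and med_distrib:
      "\<lbrakk>x \<in> carrier M; y \<in> carrier M; z \<in> carrier M; u \<in> carrier M; v \<in> carrier M\<rbrakk>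
        \<Longrightarrow> med M (med M x y z) u v = med M x (med M y u v) (med M z u v)"

definition median_hom :: "'a median_struct \<Rightarrow> 'b median_struct \<Rightarrow> ('a \<Rightarrow> 'b) set" where
  "median_hom M N =
     {f. f \<in> carrier M \<rightarrow> carrier N \<and>
         (\<forall>x\<in>carrier M. \<forall>y\<in>carrier M. \<forall>z\<in>carrier M.
            f (med M x y z) = med N (f x) (f y) (f z))}"

definition median_closed :: "'a median_struct \<Rightarrow> 'a set \<Rightarrow> bool" where
  "median_closed M N \<longleftrightarrow>
     N \<subseteq> carrier M \<and> (\<forall>x\<in>N. \<forall>y\<in>N. \<forall>z\<in>N. med M x y z \<in> N)"

definition generated_subalgebra :: "'a median_struct \<Rightarrow> 'a set \<Rightarrow> 'a median_struct" where
  "generated_subalgebra M S = M\<lparr>carrier := \<Inter>{N. median_closed M N \<and> S \<subseteq> N}\<rparr>"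

definition median_convex :: "'a median_struct \<Rightarrow> 'a set \<Rightarrow> bool" where
  "median_convex M C \<longleftrightarrow>
     C \<subseteq> carrier M \<and> (\<forall>x\<in>C. \<forall>y\<in>C. \<forall>z\<in>carrier M. med M x y z \<in> C)"

definition half_space :: "'a median_struct \<Rightarrow> 'a set \<Rightarrow> bool" where
  "half_space M H \<longleftrightarrow> median_convex M H \<and> median_convex M (carrier M - H)"

record 'a poc_struct = "'a partial_object" +
  le :: "'a \<Rightarrow> 'a \<Rightarrow> bool"
  star :: "'a \<Rightarrow> 'a"
  bottom :: 'a

locale poc_set =
  fixes P :: "'a poc_struct"
  assumes le_refl: "a \<in> carrier P \<Longrightarrow> le P a a"
    and le_antisym:
      "\<lbrakk>a \<in> carrier P; b \<in> carrier P; le P a b; le P b a\<rbrakk> \<Longrightarrow> a = b"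
    and le_trans:
      "\<lbrakk>a \<in> carrier P; b \<in> carrier P; c \<in> carrier P; le P a b; le P b c\<rbrakk> \<Longrightarrow> le P a c"
    and bottom_closed: "bottom P \<in> carrier P"
    and bottom_le: "a \<in> carrier P \<Longrightarrow> le P (bottom P) a"
    and star_closed: "a \<in> carrier P \<Longrightarrow> star P a \<in> carrier P"
    and star_star: "a \<in> carrier P \<Longrightarrow> star P (star P a) = a"
    and star_antimono:
      "\<lbrakk>a \<in> carrier P; b \<in> carrier P; le P a b\<rbrakk> \<Longrightarrow> le P (star P b) (star P a)"
    and le_star_imp_bottom:
      "\<lbrakk>a \<in> carrier P; le P a (star P a)\<rbrakk> \<Longrightarrow> a = bottom P"
    and bottom_neq_star: "bottom P \<noteq> star P (bottom P)"

definition poc_iso :: "'a poc_struct \<Rightarrow> 'b poc_struct \<Rightarrow> ('a \<Rightarrow> 'b) set" where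
  "poc_iso P Q =
     {f. poc_set P \<and> poc_set Q \<and>
         bij_betw f (carrier P) (carrier Q) \<and>
         (\<forall>a\<in>carrier P. \<forall>b\<in>carrier P. le P a b \<longleftrightarrow> le Q (f a) (f b)) \<and>
         f (bottom P) = bottom Q \<and>
         (\<forall>a\<in>carrier P. f (star P a) = star Q (f a))}"

definition ultra_filter :: "'a poc_struct \<Rightarrow> 'a set \<Rightarrow> bool" where
  "ultra_filter P U \<longleftrightarrow>
     U \<subseteq> carrier P \<and>
     (\<forall>a\<in>U. \<forall>b\<in>carrier P. le P a b \<longrightarrow> b \<in> U) \<and>
     U \<union> star P ` U = carrier P \<and> U \<inter> star P ` U = {}"

definition median_dual :: "'a median_struct \<Rightarrow> 'a set poc_struct" where
  "median_dual M =
     \<lparr>carrier = {H. half_space M H}, le = (\<subseteq>), star = (\<lambda>H. carrier M - H), bottom = {}\<rparr>"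

definition poc_dual :: "'a poc_struct \<Rightarrow> 'a set median_struct" where
  "poc_dual P =
     \<lparr>carrier = {U. ultra_filter P U}, med = (\<lambda>U V W. (U \<inter> V) \<union> (V \<inter> W) \<union> (W \<inter> U))\<rparr>"

definition powerset_poc :: "'a set \<Rightarrow> 'a set poc_struct" where
  "powerset_poc X =
     \<lparr>carrier = Pow X, le = (\<subseteq>), star = (\<lambda>a. X - a), bottom = {}\<rparr>"

text \<open>This is both the map \<open>\<pi>\<close> into the dual of the power set and its corestriction \<open>\<iota>\<close>
  to \<open>Med X\<close>.\<close>

definition iota :: "'a set \<Rightarrow> 'a \<Rightarrow> 'a set set" where
  "iota X x = {a \<in> Pow X. x \<in> a}"

definition Med :: "'a set \<Rightarrow> 'a set set median_struct" where
  "Med X = generated_subalgebra (poc_dual (powerset_poc X)) (iota X ` X)"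

end

theory Submission
  imports Defs
begin

text \<open>
  Everything rests on one representation fact: in a median algebra two distinct points are
  separated by a half space (\<open>half_space_separation\<close>, by Zorn's lemma). Hence a point is
  determined by the half spaces that contain it, and a median of points corresponds to the
  Boolean majority of these families of half spaces (\<open>med_mem_half_space\<close>).

  For freeness, let \<open>\<phi>: X \<rightarrow> M\<close>. An element \<open>U\<close> of \<open>Med X\<close> selects the half spaces \<open>H\<close> of \<open>M\<close>
  with \<open>\<phi>\<^sup>-\<^sup>1(H) \<in> U\<close>. For \<open>U = \<iota>(x)\<close> these are exactly the half spaces containing \<open>\<phi>(x)\<close>, and the
  selection commutes with medians; therefore, by induction over the generation of \<open>Med X\<close>, every
  \<open>U\<close> selects the half spaces around a point of \<open>M\<close>, which is unique by separation. This point
  is the value of the extension at \<open>U\<close>. Uniqueness of the extension, and likewise the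
  fact that a half space \<open>H\<close> of \<open>Med X\<close> is \<open>{U. \<iota>\<^sup>-\<^sup>1(H) \<in> U}\<close>, hold because two morphisms that
  agree on generators agree everywhere.

  Each element of \<open>Med X\<close> is decided by a finite subset of \<open>X\<close>, since this is true of the
  generators and inherited by medians; an infinite \<open>X\<close> carries an ultra filter without this
  property. For finite \<open>X\<close> the argument is that of Baker and Pixley: any two members of an ultra
  filter \<open>U\<close> meet, so they lie in a common \<open>\<iota>(x)\<close>; the majority operation then
  promotes this from two members to any finite number of members, hence to all of \<open>U\<close>.
\<close>

section \<open>Convexity and separation in median algebras\<close>

context median_algebra
begin

lemma med_swap_left:
  assumes "x \<in> carrier M" "y \<in> carrier M" "z \<in> carrier M"
  shows "med M x y z = med M y x z"
  using med_rotate[of x y z] med_swap[of y z x] assms by simp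

lemma med_majority_left:
  assumes "x \<in> carrier M" "y \<in> carrier M"
  shows "med M x y y = y"
  using med_rotate[of x y y] med_majority[of y x] assms by simp

text \<open>For fixed \<open>u\<close>, the relation \<open>med M u p q = p\<close> (\<open>p\<close> lies between \<open>u\<close> and \<open>q\<close>) is the order of
  the meet semilattice \<open>(p, q) \<mapsto> med M u p q\<close> with least element \<open>u\<close>. The next two lemmas give
  its transitivity and the monotonicity of the median with respect to it.\<close>

lemma between_trans:
  assumes "u \<in> carrier M" "p \<in> carrier M" "q \<in> carrier M" "r \<in> carrier M"
    and pq: "med M u p q = p" and qr: "med M u q r = q"
  shows "med M u p r = p"
proof -
  have "med M u p r = med M (med M p u q) u r"
    using assms med_swap_left[of p u q] med_swap_left[of p u r] by simp
  also have "\<dots> = med M p (med M u u r) (med M q u r)"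
    using assms by (simp add: med_distrib)
  also have "\<dots> = med M p u q"
    using assms med_majority[of u r] med_swap_left[of q u r] by simp
  also have "\<dots> = p"
    using assms med_swap_left[of p u q] by simp
  finally show ?thesis .
qed

lemma between_mono:
  assumes "u \<in> carrier M" "p \<in> carrier M" "q \<in> carrier M" "s \<in> carrier M" "t \<in> carrier M"
    and pq: "med M u p q = p"
  shows "med M u (med M p s t) (med M q s t) = med M p s t"
  using med_distrib[of u p q s t] assms by simp

text \<open>This is the join of \<open>C\<close> with the point \<open>u\<close>: its elements lie below elements of \<open>C\<close> in the order
  based at \<open>u\<close>. If \<open>y\<close> lies below \<open>h\<close> and \<open>z\<close> below \<open>k\<close>, then \<open>med M y z t\<close> lies below
  \<open>med M h k t\<close> by monotonicity in two arguments, and the latter is in \<open>C\<close> by convexity.\<close>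

lemma median_convex_join_point:
  assumes C: "median_convex M C" and u: "u \<in> carrier M"
  shows "median_convex M {z \<in> carrier M. \<exists>h\<in>C. med M u z h = z}"
  unfolding median_convex_def
proof (intro conjI ballI)
  fix y z t
  assume y': "y \<in> {z \<in> carrier M. \<exists>h\<in>C. med M u z h = z}"
    and z': "z \<in> {z \<in> carrier M. \<exists>h\<in>C. med M u z h = z}" and t: "t \<in> carrier M"
  from y' obtain h where y: "y \<in> carrier M" and h: "h \<in> C" "med M u y h = y" by blast
  from z' obtain k where z: "z \<in> carrier M" and k: "k \<in> C" "med M u z k = z" by blast
  have hk: "h \<in> carrier M" "k \<in> carrier M" "med M h k t \<in> C"
    using C h k t by (auto simp: median_convex_def)
  have step1: "med M u (med M y z t) (med M h z t) = med M y z t"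
    using between_mono[of u y h z t] u y z t hk h by simp
  have "med M u (med M z h t) (med M k h t) = med M z h t"
    using between_mono[of u z k h t] u y z t hk k by simp
  then have step2: "med M u (med M h z t) (med M h k t) = med M h z t"
    using hk z t med_swap_left[of z h t] med_swap_left[of k h t] by simp
  have "med M u (med M y z t) (med M h k t) = med M y z t"
    using between_trans[OF _ _ _ _ step1 step2] u y z t hk by (simp add: med_closed)
  then show "med M y z t \<in> {z \<in> carrier M. \<exists>h\<in>C. med M u z h = z}"
    using hk y z t by (auto simp: med_closed)
qed auto

text \<open>The separating half space is a convex set \<open>H\<close> that is maximal among those containing \<open>x\<close> but not
  \<open>y\<close>. If its complement had points \<open>u\<close>, \<open>v\<close> with a point \<open>w\<close> of \<open>H\<close> between them, then
  maximality would put \<open>y\<close> into the join of \<open>H\<close> with \<open>u\<close> and into the join of \<open>H\<close> with \<open>v\<close>, say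
  between \<open>u\<close> and \<open>h\<close> and between \<open>v\<close> and \<open>k\<close>. In the semilattice \<open>p \<squnion> q = med M p q y\<close> with
  greatest element \<open>y\<close>, the element \<open>h \<squnion> k \<squnion> w\<close> of \<open>H\<close> is then \<open>y\<close> itself.\<close>

theorem half_space_separation:
  assumes x: "x \<in> carrier M" and y: "y \<in> carrier M" and "x \<noteq> y"
  obtains H where "half_space M H" "x \<in> H" "y \<notin> H"
proof -
  let ?A = "{C. median_convex M C \<and> x \<in> C \<and> y \<notin> C}"
  have x1: "{x} \<in> ?A"
    using assms by (auto simp: median_convex_def med_majority)
  have "\<exists>H\<in>?A. \<forall>C\<in>?A. H \<subseteq> C \<longrightarrow> C = H"
  proof (rule subset_Zorn_nonempty)
    show "?A \<noteq> {}" using x1 by blast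
  next
    fix \<C> assume "\<C> \<noteq> {}" and chain: "subset.chain ?A \<C>"
    have "\<C> \<subseteq> ?A" using chain by (auto simp: subset_chain_def)
    moreover have "median_convex M (\<Union>\<C>)"
      unfolding median_convex_def
    proof (intro conjI ballI)
      show "\<Union>\<C> \<subseteq> carrier M" using \<open>\<C> \<subseteq> ?A\<close> by (auto simp: median_convex_def)
    next
      fix p q r assume "p \<in> \<Union>\<C>" "q \<in> \<Union>\<C>" and r: "r \<in> carrier M"
      then obtain C D where CD: "C \<in> \<C>" "D \<in> \<C>" "p \<in> C" "q \<in> D" by blast
      then have "C \<subseteq> D \<or> D \<subseteq> C" using chain by (auto simp: subset_chain_def)
      then obtain E where "E \<in> \<C>" "p \<in> E" "q \<in> E" using CD by blast
      moreover from this have "median_convex M E" using \<open>\<C> \<subseteq> ?A\<close> by blast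
      ultimately show "med M p q r \<in> \<Union>\<C>" using r unfolding median_convex_def by blast
    qed
    ultimately show "\<Union>\<C> \<in> ?A" using \<open>\<C> \<noteq> {}\<close> by blast
  qed
  then obtain H where H: "median_convex M H" "x \<in> H" "y \<notin> H"
    and maximal: "\<And>C. median_convex M C \<Longrightarrow> x \<in> C \<Longrightarrow> y \<notin> C \<Longrightarrow> H \<subseteq> C \<Longrightarrow> C = H"
    by blast
  have HM: "H \<subseteq> carrier M" using H(1) by (simp add: median_convex_def)
  have H_med: "med M p q r \<in> H" if "p \<in> H" "q \<in> H" "r \<in> carrier M" for p q r
    using H(1) that by (simp add: median_convex_def)
  have below_H: "\<exists>h\<in>H. med M u h y = y" if u: "u \<in> carrier M - H" for u
  proof -
    let ?J = "{z \<in> carrier M. \<exists>h\<in>H. med M u z h = z}"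
    have "H \<subseteq> ?J"
    proof
      fix h assume h: "h \<in> H"
      then have "med M u h h = h" using u HM by (auto simp: med_majority_left)
      then show "h \<in> ?J" using h HM by blast
    qed
    moreover have "u \<in> ?J" using u H(2) x by (auto intro!: bexI[of _ x] simp: med_majority)
    ultimately have "y \<in> ?J"
      using maximal[of ?J] median_convex_join_point[OF H(1), of u] u H(2) by blast
    then obtain h where h: "h \<in> H" "med M u y h = y" by blast
    then have "med M u h y = y" using med_swap[of u y h] u y HM by auto
    then show ?thesis using h(1) by blast
  qed
  have "median_convex M (carrier M - H)"
    unfolding median_convex_def
  proof (intro conjI ballI)
    fix u v r assume u: "u \<in> carrier M - H" and v: "v \<in> carrier M - H" and r: "r \<in> carrier M"
    define w where "w = med M u v r"
    have "w \<notin> H"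
    proof
      assume w: "w \<in> H"
      obtain h k where h: "h \<in> H" "med M u h y = y" and k: "k \<in> H" "med M v k y = y"
        using below_H u v by metis
      have c: "u \<in> carrier M" "v \<in> carrier M" "w \<in> carrier M" "h \<in> carrier M" "k \<in> carrier M"
        using u v w h k HM by auto
      have assoc: "med M (med M p q y) s y = med M p (med M q s y) y"
        if "p \<in> carrier M" "q \<in> carrier M" "s \<in> carrier M" for p q s
      proof -
        have "med M (med M p q y) s y = med M p (med M q s y) (med M y s y)"
          using that y by (simp add: med_distrib)
        moreover have "med M y s y = y" using that y med_swap[of y s y] med_majority[of y s] by simp
        ultimately show ?thesis by simp
      qed
      have comm: "med M p q y = med M q p y" if "p \<in> carrier M" "q \<in> carrier M" for p q
        using that y by (simp add: med_swap_left)
      have top: "med M p y y = y" if "p \<in> carrier M" for p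
        using that y by (rule med_majority_left)
      define z where "z = med M (med M w h y) k y"
      have zH: "z \<in> H" unfolding z_def using w h k y by (intro H_med)
      then have zc: "z \<in> carrier M" using HM by blast
      have zu: "med M u z y = y"
      proof -
        have "z = med M (med M h w y) k y"
          unfolding z_def using comm[of w h] c by simp
        also have "\<dots> = med M h (med M w k y) y"
          using assoc c by simp
        finally have "med M u z y = med M (med M u h y) (med M w k y) y"
          using assoc[of u h "med M w k y"] c y by (simp add: med_closed)
        also have "\<dots> = y"
          using h comm[of y "med M w k y"] top[of "med M w k y"] med_majority[of y "med M w k y"]
            med_swap[of y "med M w k y" y] c y
          by (simp add: med_closed)
        finally show ?thesis .
      qed
      have zv: "med M v z y = y"
      proof -
        have "z = med M k (med M w h y) y"
          unfolding z_def using comm[of "med M w h y" k] c y by (simp add: med_closed)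
        then have "med M v z y = med M (med M v k y) (med M w h y) y"
          using assoc[of v k "med M w h y"] c y by (simp add: med_closed)
        also have "\<dots> = y"
          using k comm[of y "med M w h y"] top[of "med M w h y"] med_majority[of y "med M w h y"]
            med_swap[of y "med M w h y" y] c y
          by (simp add: med_closed)
        finally show ?thesis .
      qed
      have zw: "med M w z y = z"
      proof -
        have "med M w w y = w" using c y by (simp add: med_majority)
        then have "med M w (med M w h y) y = med M w h y"
          using assoc[of w w h] c by simp
        then show ?thesis
          unfolding z_def using assoc[of w "med M w h y" k] c y by (simp add: med_closed)
      qed
      \<comment> \<open>As \<open>w\<close> lies below \<open>z\<close>, joining \<open>z\<close> to \<open>w = med M u v r\<close> gives \<open>z\<close>; by distributivity it
        also gives a median in which \<open>u \<squnion> z = y\<close> and \<open>v \<squnion> z = y\<close> form a majority.\<close>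
      have "z = med M (med M r u v) z y"
        using zw c r med_rotate[of r u v] unfolding w_def by simp
      also have "\<dots> = med M r (med M u z y) (med M v z y)"
        using c zc y r by (simp add: med_distrib)
      also have "\<dots> = y" using zu zv top r by simp
      finally show False using zH H(3) by simp
    qed
    then show "med M u v r \<in> carrier M - H"
      using u v r by (auto simp: w_def med_closed)
  qed auto
  then have "half_space M H" using H(1) by (simp add: half_space_def)
  then show ?thesis using that H by blast
qed

text \<open>The indicator function of a half space is a morphism to the two-element median algebra: two of
  the three points lie on the same side, and so does their median.\<close>

lemma med_mem_half_space:
  assumes "half_space M H" and c: "x \<in> carrier M" "y \<in> carrier M" "z \<in> carrier M"
  shows "med M x y z \<in> H \<longleftrightarrow> x \<in> H \<and> y \<in> H \<or> y \<in> H \<and> z \<in> H \<or> z \<in> H \<and> x \<in> H"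
proof -
  have two: "med M x y z \<in> C"
    if C: "median_convex M C" and "x \<in> C \<and> y \<in> C \<or> y \<in> C \<and> z \<in> C \<or> z \<in> C \<and> x \<in> C" for C
  proof -
    have "med M x y z = med M y z x" "med M x y z = med M z x y"
      using c by (simp_all add: med_rotate[of x y z] med_rotate[of y z x])
    moreover have "med M p q r \<in> C" if "p \<in> C" "q \<in> C" "r \<in> carrier M" for p q r
      using C that by (simp add: median_convex_def)
    ultimately show ?thesis using that(2) c by metis
  qed
  have "median_convex M H" "median_convex M (carrier M - H)"
    using assms by (auto simp: half_space_def)
  then show ?thesis using two[of H] two[of "carrier M - H"] c by auto
qed

lemma points_eqI_half_spaces:
  assumes "x \<in> carrier M" "y \<in> carrier M" and "\<And>H. half_space M H \<Longrightarrow> x \<in> H \<longleftrightarrow> y \<in> H"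
  shows "x = y"
  using half_space_separation[OF assms(1,2)] assms(3) by blast

lemma half_space_subset: "half_space M H \<Longrightarrow> H \<subseteq> carrier M"
  by (simp add: half_space_def median_convex_def)

lemma half_space_empty: "half_space M {}"
  by (simp add: half_space_def median_convex_def med_closed)

lemma half_space_complement: "half_space M H \<Longrightarrow> half_space M (carrier M - H)"
  using half_space_subset[of H] by (simp add: half_space_def double_diff)

lemma median_dual_poc_set: "poc_set (median_dual M)"
proof
  show "bottom (median_dual M) \<noteq> star (median_dual M) (bottom (median_dual M))"
    using nonempty by (simp add: median_dual_def)
qed (use half_space_subset half_space_empty half_space_complement in
    \<open>auto simp: median_dual_def double_diff\<close>)

end


section \<open>Generated subalgebras\<close>

lemma generated_subalgebra_incl:
  "S \<subseteq> carrier (generated_subalgebra M S)"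
  by (auto simp: generated_subalgebra_def)

lemma med_generated_subalgebra [simp]: "med (generated_subalgebra M S) = med M"
  by (simp add: generated_subalgebra_def)

lemma generated_subalgebra_least:
  assumes "median_closed M N" "S \<subseteq> N"
  shows "carrier (generated_subalgebra M S) \<subseteq> N"
  using assms by (auto simp: generated_subalgebra_def)

lemma generated_subalgebra_closed:
  assumes "U \<in> carrier (generated_subalgebra M S)" "V \<in> carrier (generated_subalgebra M S)"
    "W \<in> carrier (generated_subalgebra M S)"
  shows "med M U V W \<in> carrier (generated_subalgebra M S)"
  using assms by (auto simp: generated_subalgebra_def median_closed_def)

lemma generated_subalgebra_induct [consumes 3, case_names generator med]:
  assumes "U \<in> carrier (generated_subalgebra M S)"
    and closed: "median_closed M (carrier M)" and S: "S \<subseteq> carrier M"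
    and gen: "\<And>s. s \<in> S \<Longrightarrow> Q s"
    and med: "\<And>U V W. \<lbrakk>U \<in> carrier (generated_subalgebra M S); V \<in> carrier (generated_subalgebra M S);
        W \<in> carrier (generated_subalgebra M S); Q U; Q V; Q W\<rbrakk> \<Longrightarrow> Q (med M U V W)"
  shows "Q U"
proof -
  let ?N = "{U \<in> carrier (generated_subalgebra M S). Q U}"
  have "carrier (generated_subalgebra M S) \<subseteq> carrier M"
    using generated_subalgebra_least closed S .
  then have "median_closed M ?N"
    unfolding median_closed_def using med generated_subalgebra_closed[of _ M S] by auto
  moreover have "S \<subseteq> ?N" using gen generated_subalgebra_incl[of S M] by auto
  ultimately show ?thesis using generated_subalgebra_least[of M ?N S] assms(1) by auto
qed


section \<open>Ultra filters in a poc set\<close>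

lemma med_poc_dual: "med (poc_dual P) U V W = (U \<inter> V) \<union> (V \<inter> W) \<union> (W \<inter> U)"
  by (simp add: poc_dual_def)

lemma carrier_poc_dual: "carrier (poc_dual P) = {U. ultra_filter P U}"
  by (simp add: poc_dual_def)

lemma (in poc_set) ultra_filter_iff:
  "ultra_filter P U \<longleftrightarrow> U \<subseteq> carrier P \<and> (\<forall>a\<in>U. \<forall>b\<in>carrier P. le P a b \<longrightarrow> b \<in> U) \<and>
     (\<forall>a\<in>carrier P. star P a \<in> U \<longleftrightarrow> a \<notin> U)"
proof -
  have "U \<union> star P ` U = carrier P \<and> U \<inter> star P ` U = {} \<longleftrightarrow>
      (\<forall>a\<in>carrier P. star P a \<in> U \<longleftrightarrow> a \<notin> U)" if U: "U \<subseteq> carrier P"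
  proof -
    have img: "a \<in> star P ` U \<longleftrightarrow> star P a \<in> U" if "a \<in> carrier P" for a
      using that U star_star by (auto intro: rev_image_eqI)
    have sub: "star P ` U \<subseteq> carrier P" using U star_closed by auto
    show ?thesis
    proof
      assume "U \<union> star P ` U = carrier P \<and> U \<inter> star P ` U = {}"
      then show "\<forall>a\<in>carrier P. star P a \<in> U \<longleftrightarrow> a \<notin> U" using img by blast
    next
      assume "\<forall>a\<in>carrier P. star P a \<in> U \<longleftrightarrow> a \<notin> U"
      then show "U \<union> star P ` U = carrier P \<and> U \<inter> star P ` U = {}"
        using img sub U by blast
    qed
  qed
  then show ?thesis unfolding ultra_filter_def by (intro conj_cong refl)
qed

lemma (in poc_set) median_closed_poc_dual: "median_closed (poc_dual P) (carrier (poc_dual P))"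
proof -
  have "ultra_filter P ((U \<inter> V) \<union> (V \<inter> W) \<union> (W \<inter> U))" (is "ultra_filter P ?m")
    if "ultra_filter P U" "ultra_filter P V" "ultra_filter P W" for U V W
  proof -
    have up: "b \<in> S" if "S \<in> {U, V, W}" "a \<in> S" "b \<in> carrier P" "le P a b" for S a b
      using that \<open>ultra_filter P U\<close> \<open>ultra_filter P V\<close> \<open>ultra_filter P W\<close>
      by (auto simp: ultra_filter_iff)
    show ?thesis
      unfolding ultra_filter_iff
    proof (intro conjI ballI impI)
      show "?m \<subseteq> carrier P" using that by (auto simp: ultra_filter_iff)
      show "b \<in> ?m" if "a \<in> ?m" "b \<in> carrier P" "le P a b" for a b
        using that up[of U a b] up[of V a b] up[of W a b] by auto
      show "star P a \<in> ?m \<longleftrightarrow> a \<notin> ?m" if "a \<in> carrier P" for a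
        using that \<open>ultra_filter P U\<close> \<open>ultra_filter P V\<close> \<open>ultra_filter P W\<close>
        by (auto simp: ultra_filter_iff)
    qed
  qed
  then show ?thesis
    unfolding median_closed_def carrier_poc_dual med_poc_dual by blast
qed

lemma median_algebra_sets:
  assumes "\<And>U V W. med M U V W = (U \<inter> V) \<union> (V \<inter> W) \<union> (W \<inter> U)"
    and "\<And>U V W. \<lbrakk>U \<in> carrier M; V \<in> carrier M; W \<in> carrier M\<rbrakk> \<Longrightarrow> med M U V W \<in> carrier M"
    and "carrier M \<noteq> {}"
  shows "median_algebra M"
  by unfold_locales (use assms in auto)


section \<open>Ultra filters in a power set\<close>

lemma powerset_poc_set:
  assumes "X \<noteq> {}"
  shows "poc_set (powerset_poc X)"
  by unfold_locales (use assms in \<open>auto simp: powerset_poc_def\<close>)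

lemma ultra_filter_powerset_iff:
  assumes "X \<noteq> {}"
  shows "ultra_filter (powerset_poc X) U \<longleftrightarrow>
    U \<subseteq> Pow X \<and> (\<forall>a\<in>U. \<forall>b. a \<subseteq> b \<and> b \<subseteq> X \<longrightarrow> b \<in> U) \<and> (\<forall>a. a \<subseteq> X \<longrightarrow> (X - a \<in> U \<longleftrightarrow> a \<notin> U))"
  unfolding poc_set.ultra_filter_iff[OF powerset_poc_set[OF assms]]
  by (auto simp: powerset_poc_def)

lemma ultra_filter_powersetD:
  assumes "X \<noteq> {}" "ultra_filter (powerset_poc X) U"
  shows "a \<in> U \<Longrightarrow> a \<subseteq> X" and "\<lbrakk>a \<in> U; a \<subseteq> b; b \<subseteq> X\<rbrakk> \<Longrightarrow> b \<in> U"
    and "a \<subseteq> X \<Longrightarrow> X - a \<in> U \<longleftrightarrow> a \<notin> U"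
  using assms(2) unfolding ultra_filter_powerset_iff[OF assms(1)] by auto

lemma mem_iota [simp]: "a \<in> iota X x \<longleftrightarrow> a \<subseteq> X \<and> x \<in> a"
  by (simp add: iota_def)

lemma iota_ultra_filter:
  assumes "x \<in> X"
  shows "ultra_filter (powerset_poc X) (iota X x)"
proof -
  have "X \<noteq> {}" using assms by blast
  then show ?thesis using assms by (auto simp: ultra_filter_powerset_iff)
qed

text \<open>If \<open>a\<close> and \<open>b\<close> were disjoint, upward closure from \<open>a\<close> would put the complement of \<open>b\<close> into \<open>U\<close>,
  next to \<open>b\<close>.\<close>

lemma ultra_filter_members_meet:
  assumes "X \<noteq> {}" "ultra_filter (powerset_poc X) U" "a \<in> U" "b \<in> U"
  shows "a \<inter> b \<noteq> {}"
proof
  assume "a \<inter> b = {}"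
  note U = ultra_filter_powersetD[OF assms(1,2)]
  have "a \<subseteq> X" "b \<subseteq> X" using assms(3,4) U(1) by auto
  then have "X - b \<in> U" using U(2)[of a "X - b"] \<open>a \<inter> b = {}\<close> assms(3) by auto
  then show False using U(3) \<open>b \<subseteq> X\<close> assms(4) by simp
qed

lemma ultra_filter_subset_imp_eq:
  assumes "X \<noteq> {}" "ultra_filter (powerset_poc X) U" "ultra_filter (powerset_poc X) V" "U \<subseteq> V"
  shows "U = V"
proof -
  note U = ultra_filter_powersetD[OF assms(1,2)] and V = ultra_filter_powersetD[OF assms(1,3)]
  have "a \<in> U" if "a \<in> V" for a
    using that assms(4) U(3)[of a] V(1,3)[of a] by auto
  then show ?thesis using assms(4) by auto
qed

text \<open>Cofinite sets are members, finite sets are not, and \<open>x\<close> decides the sets that are neither.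
  Such a family need not be closed under intersections.\<close>

lemma cofinite_or_point_ultra_filter:
  assumes "infinite X" "x \<in> X"
  shows "ultra_filter (powerset_poc X) {a. a \<subseteq> X \<and> (finite (X - a) \<or> infinite a \<and> x \<in> a)}"
proof -
  let ?U = "{a. a \<subseteq> X \<and> (finite (X - a) \<or> infinite a \<and> x \<in> a)}"
  have "X \<noteq> {}" using assms by blast
  moreover have "b \<in> ?U" if "a \<in> ?U" "a \<subseteq> b" "b \<subseteq> X" for a b
  proof -
    have "finite (X - a) \<Longrightarrow> finite (X - b)" using that(2) by (meson Diff_mono finite_subset order_refl)
    moreover have "infinite a \<Longrightarrow> infinite b" using that(2) finite_subset by blast
    ultimately show ?thesis using that by auto
  qed
  moreover have "X - a \<in> ?U \<longleftrightarrow> a \<notin> ?U" if "a \<subseteq> X" for a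
  proof -
    have "infinite a \<or> infinite (X - a)" using assms(1) finite_Diff2[of a X] by auto
    then show ?thesis using that assms(2) by (auto simp: double_diff)
  qed
  ultimately show ?thesis by (auto simp: ultra_filter_powerset_iff)
qed


section \<open>The median algebra generated by the principal ultra filters\<close>

lemma med_Med: "med (Med X) U V W = (U \<inter> V) \<union> (V \<inter> W) \<union> (W \<inter> U)"
  by (simp add: Med_def med_poc_dual)

lemma iota_in_Med: "x \<in> X \<Longrightarrow> iota X x \<in> carrier (Med X)"
  using generated_subalgebra_incl[of "iota X ` X"] by (auto simp: Med_def)

lemma iota_subset_poc_dual: "iota X ` X \<subseteq> carrier (poc_dual (powerset_poc X))"
  by (auto simp: carrier_poc_dual iota_ultra_filter)

lemma Med_ultra_filter:
  assumes "X \<noteq> {}" "U \<in> carrier (Med X)"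
  shows "ultra_filter (powerset_poc X) U"
  using generated_subalgebra_least[OF
      poc_set.median_closed_poc_dual[OF powerset_poc_set[OF assms(1)]] iota_subset_poc_dual]
    assms(2) by (auto simp: Med_def carrier_poc_dual)

lemma median_algebra_Med:
  assumes "X \<noteq> {}"
  shows "median_algebra (Med X)"
proof (rule median_algebra_sets)
  show "carrier (Med X) \<noteq> {}" using assms iota_in_Med by (metis ex_in_conv)
  show "med (Med X) U V W \<in> carrier (Med X)"
    if "U \<in> carrier (Med X)" "V \<in> carrier (Med X)" "W \<in> carrier (Med X)" for U V W
    using that generated_subalgebra_closed[of U _ _ V W] unfolding Med_def by simp
qed (fact med_Med)

lemma Med_induct [consumes 2, case_names iota med]:
  assumes "X \<noteq> {}" "U \<in> carrier (Med X)"
    and gen: "\<And>x. x \<in> X \<Longrightarrow> Q (iota X x)"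
    and med: "\<And>U V W. \<lbrakk>U \<in> carrier (Med X); V \<in> carrier (Med X); W \<in> carrier (Med X);
        Q U; Q V; Q W\<rbrakk> \<Longrightarrow> Q (med (Med X) U V W)"
  shows "Q U"
  using assms(2)[unfolded Med_def]
    poc_set.median_closed_poc_dual[OF powerset_poc_set[OF assms(1)]] iota_subset_poc_dual
proof (induction rule: generated_subalgebra_induct)
  case (generator s)
  then show ?case using gen by auto
next
  case (med U V W)
  then show ?case using assms(4)[of U V W] by (simp add: Med_def)
qed


section \<open>The universal property\<close>

lemma median_hom_Med_unique:
  assumes "X \<noteq> {}" "f \<in> median_hom (Med X) M" "g \<in> median_hom (Med X) M"
    and "\<And>x. x \<in> X \<Longrightarrow> f (iota X x) = g (iota X x)"
    and "U \<in> carrier (Med X)"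
  shows "f U = g U"
  using assms(1,5)
proof (induction rule: Med_induct)
  case (iota x)
  then show ?case by (rule assms(4))
next
  case (med U V W)
  then show ?case using assms(2,3) by (simp add: median_hom_def)
qed

text \<open>The point \<open>p\<close> is the value at \<open>U\<close> of the extension of \<open>\<phi>\<close>: any morphism extending \<open>\<phi>\<close>
  pulls a half space \<open>H\<close> back to a half space of \<open>Med X\<close> with trace \<open>\<phi> -` H \<inter> X\<close> on \<open>X\<close>,
  and such a half space consists of the elements that contain its trace.\<close>

lemma Med_selects_point:
  assumes "X \<noteq> {}" "median_algebra M" and \<phi>: "\<phi> \<in> X \<rightarrow> carrier M" and "U \<in> carrier (Med X)"
  shows "\<exists>!p. p \<in> carrier M \<and> (\<forall>H. half_space M H \<longrightarrow> (p \<in> H \<longleftrightarrow> \<phi> -` H \<inter> X \<in> U))"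
proof -
  interpret M: median_algebra M by fact
  have "\<exists>p\<in>carrier M. \<forall>H. half_space M H \<longrightarrow> (p \<in> H \<longleftrightarrow> \<phi> -` H \<inter> X \<in> U)"
    using assms(1,4)
  proof (induction rule: Med_induct)
    case (iota x)
    then show ?case using \<phi> by (intro bexI[of _ "\<phi> x"]) auto
  next
    case (med U V W)
    from med.IH(1) obtain p where
      "p \<in> carrier M" "\<forall>H. half_space M H \<longrightarrow> (p \<in> H \<longleftrightarrow> \<phi> -` H \<inter> X \<in> U)" by blast
    moreover from med.IH(2) obtain q where
      "q \<in> carrier M" "\<forall>H. half_space M H \<longrightarrow> (q \<in> H \<longleftrightarrow> \<phi> -` H \<inter> X \<in> V)" by blast
    moreover from med.IH(3) obtain r where
      "r \<in> carrier M" "\<forall>H. half_space M H \<longrightarrow> (r \<in> H \<longleftrightarrow> \<phi> -` H \<inter> X \<in> W)" by blast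
    ultimately show ?case
      by (intro bexI[of _ "med M p q r"]) (auto simp: M.med_mem_half_space M.med_closed med_Med)
  qed
  then obtain p where p: "p \<in> carrier M"
    "\<And>H. half_space M H \<Longrightarrow> p \<in> H \<longleftrightarrow> \<phi> -` H \<inter> X \<in> U" by auto
  show ?thesis
    by (rule ex1I[of _ p]) (use p in \<open>auto intro: M.points_eqI_half_spaces\<close>)
qed

lemma Med_extension_exists:
  assumes "X \<noteq> {}" "median_algebra M" and \<phi>: "\<phi> \<in> X \<rightarrow> carrier M"
  obtains f where "f \<in> median_hom (Med X) M" "f \<in> extensional (carrier (Med X))"
    "\<forall>x\<in>X. f (iota X x) = \<phi> x"
proof -
  interpret M: median_algebra M by fact
  interpret Med: median_algebra "Med X" using assms(1) by (rule median_algebra_Med)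
  define f where "f = (\<lambda>U\<in>carrier (Med X). THE p. p \<in> carrier M \<and>
    (\<forall>H. half_space M H \<longrightarrow> (p \<in> H \<longleftrightarrow> \<phi> -` H \<inter> X \<in> U)))"
  have f: "f U \<in> carrier M" "\<And>H. half_space M H \<Longrightarrow> f U \<in> H \<longleftrightarrow> \<phi> -` H \<inter> X \<in> U"
    if "U \<in> carrier (Med X)" for U
    using theI'[OF Med_selects_point[OF assms that]] that by (simp_all add: f_def)
  have "f (med (Med X) U V W) = med M (f U) (f V) (f W)"
    if "U \<in> carrier (Med X)" "V \<in> carrier (Med X)" "W \<in> carrier (Med X)" for U V W
    using that
    by (intro M.points_eqI_half_spaces)
      (auto simp: f Med.med_closed M.med_closed M.med_mem_half_space, auto simp: med_Med)
  then have "f \<in> median_hom (Med X) M" using f by (auto simp: median_hom_def)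
  moreover have "f \<in> extensional (carrier (Med X))" by (simp add: f_def)
  moreover have "\<forall>x\<in>X. f (iota X x) = \<phi> x"
  proof
    fix x assume "x \<in> X"
    then show "f (iota X x) = \<phi> x"
      using \<phi> iota_in_Med[of x X]
      by (intro M.points_eqI_half_spaces) (auto simp: f)
  qed
  ultimately show ?thesis by (rule that)
qed


section \<open>The half spaces of the free median algebra\<close>

lemma half_space_Med_of_subset:
  assumes "X \<noteq> {}" "a \<subseteq> X"
  shows "half_space (Med X) {U \<in> carrier (Med X). a \<in> U}"
proof -
  interpret median_algebra "Med X" using assms(1) by (rule median_algebra_Med)
  show ?thesis
    unfolding half_space_def median_convex_def by (auto simp: med_closed) (auto simp: med_Med)
qed

text \<open>Membership in \<open>H\<close> and membership of the trace of \<open>H\<close> are morphisms to the two-element median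
  algebra that agree on the generators.\<close>

lemma half_space_Med_eq:
  assumes "X \<noteq> {}" and H: "half_space (Med X) H"
  shows "H = {U \<in> carrier (Med X). iota X -` H \<inter> X \<in> U}"
proof -
  interpret median_algebra "Med X" using assms(1) by (rule median_algebra_Med)
  have "U \<in> H \<longleftrightarrow> iota X -` H \<inter> X \<in> U" if "U \<in> carrier (Med X)" for U
    using assms(1) that
  proof (induction rule: Med_induct)
    case (iota x)
    then show ?case by auto
  next
    case (med U V W)
    then show ?case by (simp add: med_mem_half_space[OF H], auto simp: med_Med)
  qed
  moreover have "H \<subseteq> carrier (Med X)" using H by (rule half_space_subset)
  ultimately show ?thesis by blast
qed

text \<open>The inverse sends a subset \<open>a\<close> to the half space of all \<open>U\<close> that contain \<open>a\<close>; it is monotone because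
  ultra filters are upward closed.\<close>

lemma iota_vimage_poc_iso:
  assumes "X \<noteq> {}"
  shows "(\<lambda>H. iota X -` H \<inter> X) \<in> poc_iso (median_dual (Med X)) (powerset_poc X)"
proof -
  interpret median_algebra "Med X" using assms by (rule median_algebra_Med)
  let ?t = "\<lambda>H. iota X -` H \<inter> X"
  let ?h = "\<lambda>a. {U \<in> carrier (Med X). a \<in> U}"
  have h_t: "?h (?t H) = H" if "half_space (Med X) H" for H
    using half_space_Med_eq[OF assms that] by simp
  have t_h: "?t (?h a) = a" if "a \<subseteq> X" for a
    using that by (auto simp: iota_in_Med)
  have "bij_betw ?t {H. half_space (Med X) H} (Pow X)"
    by (rule bij_betw_byWitness[where f' = ?h])
      (use h_t t_h half_space_Med_of_subset[OF assms] in auto)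
  moreover have "H \<subseteq> K \<longleftrightarrow> ?t H \<subseteq> ?t K" if "half_space (Med X) H" "half_space (Med X) K" for H K
  proof
    assume sub: "?t H \<subseteq> ?t K"
    have "?h (?t H) \<subseteq> ?h (?t K)"
    proof
      fix U assume U: "U \<in> ?h (?t H)"
      then have "ultra_filter (powerset_poc X) U" using Med_ultra_filter[OF assms] by simp
      then show "U \<in> ?h (?t K)"
        using U sub ultra_filter_powersetD(2)[OF assms, of U "?t H" "?t K"] by simp
    qed
    then show "H \<subseteq> K" using h_t that by simp
  qed auto
  moreover have "?t (carrier (Med X) - H) = X - ?t H" for H
    by (auto simp: iota_in_Med)
  ultimately show ?thesis
    using median_dual_poc_set powerset_poc_set[OF assms]
    unfolding poc_iso_def by (simp add: median_dual_def powerset_poc_def)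
qed


section \<open>Finiteness\<close>

text \<open>If \<open>A\<close> has three distinct elements, members of \<open>Med X\<close> that contain all of \<open>A\<close> except possibly
  one of the three have a median that contains every element of \<open>A\<close>, since it is lost by at most
  one of them. This reduces to sets of at most two elements, where a common point \<open>x\<close> of two
  members of \<open>U\<close> gives \<open>iota X x\<close> as the element sought.\<close>

lemma Med_contains_finite_part:
  assumes "X \<noteq> {}" and U: "ultra_filter (powerset_poc X) U" and "finite A" "A \<subseteq> U"
  shows "\<exists>V\<in>carrier (Med X). A \<subseteq> V"
  using \<open>finite A\<close> \<open>A \<subseteq> U\<close>
proof (induction A rule: finite_psubset_induct)
  case (psubset A)
  interpret median_algebra "Med X" using assms(1) by (rule median_algebra_Med)
  show ?case
  proof (cases "\<exists>a b c. a \<in> A \<and> b \<in> A \<and> c \<in> A \<and> a \<noteq> b \<and> b \<noteq> c \<and> c \<noteq> a")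
    case True
    then obtain a b c where abc: "a \<in> A" "b \<in> A" "c \<in> A" "a \<noteq> b" "b \<noteq> c" "c \<noteq> a" by blast
    have "\<exists>V\<in>carrier (Med X). A - {d} \<subseteq> V" if "d \<in> A" for d
      using psubset.IH[of "A - {d}"] psubset.prems that by blast
    then obtain V1 V2 V3 where V: "V1 \<in> carrier (Med X)" "V2 \<in> carrier (Med X)" "V3 \<in> carrier (Med X)"
      "A - {a} \<subseteq> V1" "A - {b} \<subseteq> V2" "A - {c} \<subseteq> V3"
      using abc by meson
    then have "A \<subseteq> med (Med X) V1 V2 V3" using abc unfolding med_Med by blast
    then show ?thesis using med_closed[OF V(1-3)] by auto
  next
    case False
    note D = ultra_filter_powersetD[OF assms(1) U]
    have "X \<in> U" using D(2)[of "{}" X] D(3)[of X] by auto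
    obtain a b where ab: "a \<in> U" "b \<in> U" "A \<subseteq> {a, b}"
    proof (cases "A = {}")
      case True
      then show ?thesis using that[of X X] \<open>X \<in> U\<close> by simp
    next
      case ne: False
      then obtain a where a: "a \<in> A" "a \<in> U" using psubset.prems by auto
      show ?thesis
      proof (cases "A \<subseteq> {a}")
        case True
        then show ?thesis using that[of a a] a by auto
      next
        case more: False
        then obtain b where b: "b \<in> A" "b \<noteq> a" by auto
        have "c = a \<or> c = b" if "c \<in> A" for c
          using False a(1) b that by metis
        then show ?thesis using that[of a b] a b psubset.prems by auto
      qed
    qed
    then obtain x where x: "x \<in> a" "x \<in> b"
      using ultra_filter_members_meet[OF assms(1) U ab(1,2)] by auto
    have "a \<subseteq> X" "b \<subseteq> X" using ab D(1) by auto
    then have "A \<subseteq> iota X x" "x \<in> X" using x ab by auto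
    then show ?thesis using iota_in_Med[of x X] by auto
  qed
qed

text \<open>A principal ultra filter is supported on its point, and a median on the union of the three
  supports.\<close>

lemma Med_finitely_supported:
  assumes "X \<noteq> {}" "U \<in> carrier (Med X)"
  shows "\<exists>F\<subseteq>X. finite F \<and> (\<forall>a b. a \<subseteq> X \<and> b \<subseteq> X \<and> a \<inter> F = b \<inter> F \<longrightarrow> (a \<in> U \<longleftrightarrow> b \<in> U))"
  using assms
proof (induction rule: Med_induct)
  case (iota x)
  then show ?case by (intro exI[of _ "{x}"]) auto
next
  case (med U V W)
  from med.IH(1) obtain F where F: "F \<subseteq> X" "finite F"
    "\<And>a b. \<lbrakk>a \<subseteq> X; b \<subseteq> X; a \<inter> F = b \<inter> F\<rbrakk> \<Longrightarrow> a \<in> U \<longleftrightarrow> b \<in> U"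
    by meson
  from med.IH(2) obtain G where G: "G \<subseteq> X" "finite G"
    "\<And>a b. \<lbrakk>a \<subseteq> X; b \<subseteq> X; a \<inter> G = b \<inter> G\<rbrakk> \<Longrightarrow> a \<in> V \<longleftrightarrow> b \<in> V"
    by meson
  from med.IH(3) obtain E where E: "E \<subseteq> X" "finite E"
    "\<And>a b. \<lbrakk>a \<subseteq> X; b \<subseteq> X; a \<inter> E = b \<inter> E\<rbrakk> \<Longrightarrow> a \<in> W \<longleftrightarrow> b \<in> W"
    by meson
  have "a \<in> med (Med X) U V W \<longleftrightarrow> b \<in> med (Med X) U V W"
    if ab: "a \<subseteq> X" "b \<subseteq> X" "a \<inter> (F \<union> G \<union> E) = b \<inter> (F \<union> G \<union> E)" for a b
  proof -
    have "a \<inter> F = b \<inter> F" "a \<inter> G = b \<inter> G" "a \<inter> E = b \<inter> E" using ab(3) by blast+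
    then show ?thesis
      using F(3)[OF ab(1,2)] G(3)[OF ab(1,2)] E(3)[OF ab(1,2)] unfolding med_Med by simp
  qed
  then show ?case using F(1,2) G(1,2) E(1,2) by (intro exI[of _ "F \<union> G \<union> E"]) simp
qed

lemma Med_eq_poc_dual_iff_finite:
  assumes "X \<noteq> {}"
  shows "Med X = poc_dual (powerset_poc X) \<longleftrightarrow> finite X"
proof
  assume "finite X"
  have "U \<in> carrier (Med X)" if U: "ultra_filter (powerset_poc X) U" for U
  proof -
    have "finite U"
      using ultra_filter_powersetD(1)[OF assms U] \<open>finite X\<close>
      by (intro finite_subset[of U "Pow X"]) auto
    then obtain V where V: "V \<in> carrier (Med X)" "U \<subseteq> V"
      using Med_contains_finite_part[OF assms U, of U] by auto
    then show ?thesis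
      using ultra_filter_subset_imp_eq[OF assms U Med_ultra_filter[OF assms V(1)]] by simp
  qed
  then have "carrier (Med X) = carrier (poc_dual (powerset_poc X))"
    using Med_ultra_filter[OF assms] by (auto simp: carrier_poc_dual)
  then show "Med X = poc_dual (powerset_poc X)"
    by (simp add: Med_def generated_subalgebra_def)
next
  assume eq: "Med X = poc_dual (powerset_poc X)"
  show "finite X"
  proof (rule ccontr)
    assume inf: "infinite X"
    obtain x where "x \<in> X" using assms by auto
    let ?U = "{a. a \<subseteq> X \<and> (finite (X - a) \<or> infinite a \<and> x \<in> a)}"
    have "?U \<in> carrier (Med X)"
      using cofinite_or_point_ultra_filter[OF inf \<open>x \<in> X\<close>] by (simp add: eq carrier_poc_dual)
    then obtain F where F: "F \<subseteq> X" "finite F"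
      and supp: "\<And>a b. \<lbrakk>a \<subseteq> X; b \<subseteq> X; a \<inter> F = b \<inter> F\<rbrakk> \<Longrightarrow> a \<in> ?U \<longleftrightarrow> b \<in> ?U"
      using Med_finitely_supported[OF assms, of ?U] by meson
    \<comment> \<open>The support \<open>F\<close> cannot distinguish the finite set \<open>F\<close> from \<open>X\<close>.\<close>
    have "F \<in> ?U \<longleftrightarrow> X \<in> ?U" using F(1) by (intro supp) auto
    moreover have "X \<in> ?U" by simp
    moreover have "F \<notin> ?U" using F inf by simp
    ultimately show False by blast
  qed
qed

section \<open>The free median algebra on a set\<close>

theorem theorem7p4:
  fixes X :: "'a set"
  assumes "X \<noteq> {}"
  shows "(median_algebra (Med X) \<and> iota X \<in> X \<rightarrow> carrier (Med X) \<and>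
          (\<forall>(M :: 'b median_struct) \<phi>.
             median_algebra M \<longrightarrow> \<phi> \<in> X \<rightarrow> carrier M \<longrightarrow>
             (\<exists>!f. f \<in> median_hom (Med X) M \<and> f \<in> extensional (carrier (Med X)) \<and>
                   (\<forall>x\<in>X. \<phi> x = f (iota X x))))) \<and>
         (\<lambda>H. iota X -` H \<inter> X) \<in> poc_iso (median_dual (Med X)) (powerset_poc X) \<and>
         (Med X = poc_dual (powerset_poc X) \<longleftrightarrow> finite X)"
proof (intro conjI allI impI)
  show "median_algebra (Med X)" using assms by (rule median_algebra_Med)
  show "iota X \<in> X \<rightarrow> carrier (Med X)" by (rule Pi_I) (rule iota_in_Med)
  show "(\<lambda>H. iota X -` H \<inter> X) \<in> poc_iso (median_dual (Med X)) (powerset_poc X)"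
    using assms by (rule iota_vimage_poc_iso)
  show "Med X = poc_dual (powerset_poc X) \<longleftrightarrow> finite X"
    using assms by (rule Med_eq_poc_dual_iff_finite)
next
  fix M :: "'b median_struct" and \<phi>
  assume M: "median_algebra M" "\<phi> \<in> X \<rightarrow> carrier M"
  obtain f where f: "f \<in> median_hom (Med X) M" "f \<in> extensional (carrier (Med X))"
    "\<forall>x\<in>X. f (iota X x) = \<phi> x"
    by (rule Med_extension_exists[OF assms M])
  show "\<exists>!f. f \<in> median_hom (Med X) M \<and> f \<in> extensional (carrier (Med X)) \<and>
      (\<forall>x\<in>X. \<phi> x = f (iota X x))"
  proof (rule ex1I, intro conjI ballI)
    fix g
    assume g: "g \<in> median_hom (Med X) M \<and> g \<in> extensional (carrier (Med X)) \<and>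
      (\<forall>x\<in>X. \<phi> x = g (iota X x))"
    then have "g (iota X x) = f (iota X x)" if "x \<in> X" for x
      using f(3) that by metis
    then have "g U = f U" if "U \<in> carrier (Med X)" for U
      using g by (intro median_hom_Med_unique[OF assms _ f(1) _ that]) auto
    then show "g = f" using g f(2) by (intro extensionalityI[of g _ f]) auto
  qed (use f in simp_all)
qed

end
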